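(* In the setting of the context, let $M:\mathbb C^n\to\mathbb C^n$ be an invertible linear map and $\tau_M:=M\tau$; for $(\Pi',\Theta')\in\mathcal E(\mathbb C^n)$ let $A_M^{\Pi',\Theta'}$ be the operator defined like $A^{\Pi',\Theta'}$ but with $\tau$ replaced by $\tau_M$ (and $G_0$ replaced by $(\tau_M A^{-1})^*$). Given $(\Pi,\Theta)\in\mathcal E(\mathbb C^n)$, let $\Pi_M$ be the orthogonal projector onto $(M^* )^{-1}(\mathbb C^n_\Pi)$ and $\Theta_M:=\Pi_MM\Pi\Theta\Pi M^*\Pi_M$ on $\mathbb C^n_{\Pi_M}$. Then $A_M^{\Pi_M,\Theta_M}=A^{\Pi,\Theta}$.
   Context: $\mathcal H$ is a Hilbert space, $S$ a closed symmetric operator on $\mathcal H$ with $-S>0$ and finite deficiency indices $(n,n)$, $n\ge1$, and $A$ a self-adjoint extension of $S$ with $-A>0$ (e.g. the Friedrichs extension), so $0\in\rho(A)$. $\tau:D(A)\to\mathbb C^n$ is a surjective linear map, bounded for the graph norm of $A$, with $\ker\tau$ dense in $\mathcal H$ and $S=A|_{\ker\tau}$. For $z\in\rho(A)$, $G_z:=(\tau(-A+\bar z)^{-1})^*:\mathbb C^n\to\mathcal H$. $\mathcal E(\mathbb C^n)$ is the set of pairs $(\Pi,\Theta)$ with $\Pi$ an orthogonal projector on $\mathbb C^n$ and $\Theta$ a symmetric operator on $\mathbb C^n_\Pi:=\mathrm{Ran}\,\Pi$ ($\Pi$ also denotes the inclusion $\mathbb C^n_\Pi\to\mathbb C^n$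 and its adjoint). For $(\Pi,\Theta)\in\mathcal E(\mathbb C^n)$, $A^{\Pi,\Theta}\phi:=A\phi_0$ on $D(A^{\Pi,\Theta}):=\{\phi=\phi_0+G_0\xi:\ \phi_0\in D(A),\ \xi\in\mathbb C^n_\Pi,\ \Pi\tau\phi_0=\Theta\xi\}$. *)

theory Defs
  imports "HOL-Analysis.Analysis"
begin

section \<open>Complex Hilbert space H, given by a complex scalar multiplication scl and an
  inner product ip (linear in the first, conjugate-linear in the second argument)\<close>

definition hnorm :: "('h \<Rightarrow> 'h \<Rightarrow> complex) \<Rightarrow> 'h \<Rightarrow> real" where
  "hnorm ip x = sqrt (Re (ip x x))"

definition hconv :: "('h::ab_group_add \<Rightarrow> 'h \<Rightarrow> complex) \<Rightarrow> (nat \<Rightarrow> 'h) \<Rightarrow> 'h \<Rightarrow> bool" where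
  "hconv ip X l \<longleftrightarrow> (\<forall>e>0. \<exists>N. \<forall>k\<ge>N. hnorm ip (X k - l) < e)"

definition chilbert :: "(complex \<Rightarrow> 'h::ab_group_add \<Rightarrow> 'h) \<Rightarrow> ('h \<Rightarrow> 'h \<Rightarrow> complex) \<Rightarrow> bool" where
  "chilbert scl ip \<longleftrightarrow>
     vector_space scl \<and>
     (\<forall>x y z. ip (x + y) z = ip x z + ip y z) \<and>
     (\<forall>c x y. ip (scl c x) y = c * ip x y) \<and>
     (\<forall>x y. ip y x = cnj (ip x y)) \<and>
     (\<forall>x. 0 \<le> Re (ip x x)) \<and>
     (\<forall>x. ip x x = 0 \<longrightarrow> x = 0) \<and>
     (\<forall>X. (\<forall>e>0. \<exists>N. \<forall>m\<ge>N. \<forall>k\<ge>N. hnorm ip (X m - X k) < e) \<longrightarrow> (\<exists>l. hconv ip X l))"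

definition hdense :: "('h::ab_group_add \<Rightarrow> 'h \<Rightarrow> complex) \<Rightarrow> 'h set \<Rightarrow> bool" where
  "hdense ip D \<longleftrightarrow> (\<forall>x. \<forall>e>0. \<exists>y\<in>D. hnorm ip (x - y) < e)"

definition hsubspace :: "(complex \<Rightarrow> 'h::ab_group_add \<Rightarrow> 'h) \<Rightarrow> 'h set \<Rightarrow> bool" where
  "hsubspace scl D \<longleftrightarrow> 0 \<in> D \<and> (\<forall>x\<in>D. \<forall>y\<in>D. x + y \<in> D) \<and> (\<forall>c. \<forall>x\<in>D. scl c x \<in> D)"

text \<open>linearity of a map defined on a subspace D\<close>
definition lin_on :: "(complex \<Rightarrow> 'a::ab_group_add \<Rightarrow> 'a) \<Rightarrow> (complex \<Rightarrow> 'b::ab_group_add \<Rightarrow> 'b)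
    \<Rightarrow> 'a set \<Rightarrow> ('a \<Rightarrow> 'b) \<Rightarrow> bool" where
  "lin_on s1 s2 D f \<longleftrightarrow> (\<forall>x\<in>D. \<forall>y\<in>D. f (x + y) = f x + f y) \<and> (\<forall>c. \<forall>x\<in>D. f (s1 c x) = s2 c (f x))"

section \<open>Unbounded operators on H: a domain D and a map S (only its values on D matter)\<close>

definition adj_dom :: "('h \<Rightarrow> 'h \<Rightarrow> complex) \<Rightarrow> 'h set \<Rightarrow> ('h \<Rightarrow> 'h) \<Rightarrow> 'h set" where
  "adj_dom ip D S = {y. \<exists>z. \<forall>x\<in>D. ip (S x) y = ip x z}"

definition adj_op :: "('h \<Rightarrow> 'h \<Rightarrow> complex) \<Rightarrow> 'h set \<Rightarrow> ('h \<Rightarrow> 'h) \<Rightarrow> 'h \<Rightarrow> 'h" where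
  "adj_op ip D S y = (SOME z. \<forall>x\<in>D. ip (S x) y = ip x z)"

definition densely_defined :: "(complex \<Rightarrow> 'h::ab_group_add \<Rightarrow> 'h) \<Rightarrow> ('h \<Rightarrow> 'h \<Rightarrow> complex)
    \<Rightarrow> 'h set \<Rightarrow> ('h \<Rightarrow> 'h) \<Rightarrow> bool" where
  "densely_defined scl ip D S \<longleftrightarrow> hsubspace scl D \<and> lin_on scl scl D S \<and> hdense ip D"

definition symmetric_op :: "(complex \<Rightarrow> 'h::ab_group_add \<Rightarrow> 'h) \<Rightarrow> ('h \<Rightarrow> 'h \<Rightarrow> complex)
    \<Rightarrow> 'h set \<Rightarrow> ('h \<Rightarrow> 'h) \<Rightarrow> bool" where
  "symmetric_op scl ip D S \<longleftrightarrow> densely_defined scl ip D S \<and> (\<forall>x\<in>D. \<forall>y\<in>D. ip (S x) y = ip x (S y))"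

definition self_adjoint_op :: "(complex \<Rightarrow> 'h::ab_group_add \<Rightarrow> 'h) \<Rightarrow> ('h \<Rightarrow> 'h \<Rightarrow> complex)
    \<Rightarrow> 'h set \<Rightarrow> ('h \<Rightarrow> 'h) \<Rightarrow> bool" where
  "self_adjoint_op scl ip D S \<longleftrightarrow> symmetric_op scl ip D S \<and> adj_dom ip D S = D"

definition closed_op :: "('h::ab_group_add \<Rightarrow> 'h \<Rightarrow> complex) \<Rightarrow> 'h set \<Rightarrow> ('h \<Rightarrow> 'h) \<Rightarrow> bool" where
  "closed_op ip D S \<longleftrightarrow> (\<forall>X l m. (\<forall>k. X k \<in> D) \<and> hconv ip X l \<and> hconv ip (\<lambda>k. S (X k)) m
       \<longrightarrow> l \<in> D \<and> S l = m)"

text \<open>B > 0 (strictly positive): \<langle>B x, x\<rangle> \<ge> c \<parallel>x\<parallel>^2 for some c > 0\<close>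
definition strictly_pos :: "('h \<Rightarrow> 'h \<Rightarrow> complex) \<Rightarrow> 'h set \<Rightarrow> ('h \<Rightarrow> 'h) \<Rightarrow> bool" where
  "strictly_pos ip D B \<longleftrightarrow> (\<exists>c>0. \<forall>x\<in>D. c * Re (ip x x) \<le> Re (ip (B x) x))"

text \<open>deficiency index: dim ker(S^* - \<lambda>)\<close>
definition def_index :: "(complex \<Rightarrow> 'h::ab_group_add \<Rightarrow> 'h) \<Rightarrow> ('h \<Rightarrow> 'h \<Rightarrow> complex)
    \<Rightarrow> 'h set \<Rightarrow> ('h \<Rightarrow> 'h) \<Rightarrow> complex \<Rightarrow> nat" where
  "def_index scl ip D S lam = vector_space.dim scl {y \<in> adj_dom ip D S. adj_op ip D S y = scl lam y}"

section \<open>The space C^n (n = CARD('n)) and matrices\<close>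

definition cinner :: "complex ^ 'n \<Rightarrow> complex ^ 'n \<Rightarrow> complex" where
  "cinner u v = (\<Sum>i\<in>UNIV. u $ i * cnj (v $ i))"

definition cadj :: "complex ^ 'n ^ 'm \<Rightarrow> complex ^ 'm ^ 'n" where
  "cadj M = (\<chi> i j. cnj (M $ j $ i))"

definition orth_proj :: "complex ^ 'n ^ 'n \<Rightarrow> bool" where
  "orth_proj P \<longleftrightarrow> P ** P = P \<and> cadj P = P"

definition rng :: "complex ^ 'n ^ 'n \<Rightarrow> (complex ^ 'n) set" where
  "rng P = range (\<lambda>x. P *v x)"

text \<open>(\<Pi>,\<Theta>) \<in> E(C^n): \<Pi> orthogonal projector, \<Theta> symmetric operator on Ran \<Pi>
  (only the values of the function \<Theta> on Ran \<Pi> matter)\<close>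
definition in_E :: "complex ^ 'n ^ 'n \<Rightarrow> (complex ^ 'n \<Rightarrow> complex ^ 'n) \<Rightarrow> bool" where
  "in_E P T \<longleftrightarrow> orth_proj P \<and> (\<forall>x\<in>rng P. T x \<in> rng P) \<and>
     lin_on (*s) (*s) (rng P) T \<and> (\<forall>x\<in>rng P. \<forall>y\<in>rng P. cinner (T x) y = cinner x (T y))"

section \<open>G_0 and the extensions A^{\<Pi>,\<Theta>}\<close>

text \<open>Hilbert adjoint T^* : C^n \<rightarrow> H of a map T : H \<rightarrow> C^n\<close>
definition hadj :: "('h \<Rightarrow> 'h \<Rightarrow> complex) \<Rightarrow> ('h \<Rightarrow> complex ^ 'n) \<Rightarrow> complex ^ 'n \<Rightarrow> 'h" where
  "hadj ip T \<xi> = (SOME g. \<forall>h. ip h g = cinner (T h) \<xi>)"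

text \<open>G_0 = (\<tau> (-A)^{-1})^*\<close>
definition G0 :: "('h \<Rightarrow> 'h \<Rightarrow> complex) \<Rightarrow> 'h set \<Rightarrow> ('h \<Rightarrow> 'h::uminus) \<Rightarrow> ('h \<Rightarrow> complex ^ 'n)
    \<Rightarrow> complex ^ 'n \<Rightarrow> 'h" where
  "G0 ip DA A \<tau> = hadj ip (\<lambda>h. \<tau> (the_inv_into DA (\<lambda>x. - A x) h))"

text \<open>Graph of A^{\<Pi>,\<Theta>} built from the trace map \<tau> (with G = G_0 of \<tau>)\<close>
definition ext_graph :: "('h \<Rightarrow> 'h \<Rightarrow> complex) \<Rightarrow> 'h set \<Rightarrow> ('h \<Rightarrow> 'h::ab_group_add)
    \<Rightarrow> ('h \<Rightarrow> complex ^ 'n) \<Rightarrow> complex ^ 'n ^ 'n \<Rightarrow> (complex ^ 'n \<Rightarrow> complex ^ 'n) \<Rightarrow> ('h \<times> 'h) set" where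
  "ext_graph ip DA A \<tau> P T =
     {(\<phi>0 + G0 ip DA A \<tau> \<xi>, A \<phi>0) | \<phi>0 \<xi>. \<phi>0 \<in> DA \<and> \<xi> \<in> rng P \<and> P *v \<tau> \<phi>0 = T \<xi>}"

text \<open>\<Theta>_M = \<Pi>_M M \<Pi> \<Theta> \<Pi> M^* \<Pi>_M\<close>
definition Theta_M :: "complex ^ 'n ^ 'n \<Rightarrow> complex ^ 'n ^ 'n \<Rightarrow> complex ^ 'n ^ 'n
    \<Rightarrow> (complex ^ 'n \<Rightarrow> complex ^ 'n) \<Rightarrow> complex ^ 'n \<Rightarrow> complex ^ 'n" where
  "Theta_M M P PM T x = PM *v (M *v (P *v T (P *v (cadj M *v (PM *v x)))))"

end

theory Submission
  imports Defs
begin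

text \<open>Replacing \<open>\<tau>\<close> by \<open>M \<tau>\<close> replaces \<open>G\<^sub>0\<close> by \<open>G\<^sub>0 M\<^sup>*\<close>, and \<open>M\<^sup>*\<close> maps \<open>Ran \<Pi>\<^sub>M\<close> bijectively
  onto \<open>Ran \<Pi>\<close>. Substituting \<open>\<eta> = M\<^sup>* \<xi>\<close>, the boundary condition \<open>\<Pi>\<^sub>M M \<tau> \<phi>\<^sub>0 = \<Theta>\<^sub>M \<xi>\<close> says that
  \<open>M (\<tau> \<phi>\<^sub>0 - \<Theta> \<eta>)\<close> is orthogonal to \<open>Ran \<Pi>\<^sub>M\<close>, i.e. that \<open>\<tau> \<phi>\<^sub>0 - \<Theta> \<eta>\<close> is orthogonal to
  \<open>M\<^sup>* Ran \<Pi>\<^sub>M = Ran \<Pi>\<close>, which is the condition \<open>\<Pi> \<tau> \<phi>\<^sub>0 = \<Theta> \<eta>\<close>.\<close>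

lemma cinner_matrix_vector_mult: "cinner (M *v v) w = cinner v (cadj M *v w)"
proof -
  have "cinner (M *v v) w = (\<Sum>i\<in>UNIV. \<Sum>j\<in>UNIV. M $ i $ j * v $ j * cnj (w $ i))"
    unfolding cinner_def matrix_vector_mult_def by (simp add: sum_distrib_right)
  also have "\<dots> = (\<Sum>j\<in>UNIV. \<Sum>i\<in>UNIV. M $ i $ j * v $ j * cnj (w $ i))"
    by (rule sum.swap)
  also have "\<dots> = cinner v (cadj M *v w)"
    unfolding cinner_def cadj_def matrix_vector_mult_def
    by (simp add: sum_distrib_left mult_ac)
  finally show ?thesis .
qed

lemma cinner_self_eq_0: "cinner u u = 0 \<longleftrightarrow> u = 0"
proof
  assume "cinner u u = 0"
  moreover have "cinner u u = of_real (\<Sum>i\<in>UNIV. (norm (u $ i))\<^sup>2)"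
    unfolding cinner_def of_real_sum complex_norm_square by simp
  ultimately have "(\<Sum>i\<in>UNIV. (norm (u $ i))\<^sup>2) = 0"
    by (simp only: of_real_eq_0_iff)
  then have "\<forall>i\<in>UNIV. (norm (u $ i))\<^sup>2 = 0"
    by (subst sum_nonneg_eq_0_iff[symmetric]) auto
  then show "u = 0" by (simp add: vec_eq_iff)
qed (simp add: cinner_def)

lemma cadj_matrix_mult: "cadj (A ** B) = cadj B ** cadj (A :: complex^'n^'n)"
  unfolding cadj_def matrix_matrix_mult_def by (simp add: vec_eq_iff mult.commute)

lemma cadj_mat_1: "cadj (mat 1 :: complex^'n^'n) = mat 1"
  unfolding cadj_def mat_def by (simp add: vec_eq_iff)

lemma invertible_cadj: "invertible M \<Longrightarrow> invertible (cadj (M :: complex^'n^'n))"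
  unfolding invertible_def by (metis cadj_matrix_mult cadj_mat_1)

lemma invertible_matrix_inv:
  assumes "invertible A"
  shows "A ** matrix_inv A = mat 1" and "matrix_inv A ** A = mat 1"
  using someI_ex[OF assms[unfolded invertible_def]] unfolding matrix_inv_def by auto

lemma orth_proj_fixes_rng: "orth_proj P \<Longrightarrow> x \<in> rng P \<Longrightarrow> P *v x = x"
  unfolding orth_proj_def rng_def by (auto simp: matrix_vector_mul_assoc)

lemma orth_proj_eq_0_iff_orthogonal:
  assumes "orth_proj P"
  shows "P *v v = 0 \<longleftrightarrow> (\<forall>y\<in>rng P. cinner v y = 0)"
proof -
  have adj: "cinner v (P *v w) = cinner (P *v v) w" for w
    using assms unfolding orth_proj_def by (metis cinner_matrix_vector_mult)
  show ?thesis
  proof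
    assume "P *v v = 0"
    then show "\<forall>y\<in>rng P. cinner v y = 0"
      unfolding rng_def by (auto simp only: adj) (simp add: cinner_def)
  next
    assume "\<forall>y\<in>rng P. cinner v y = 0"
    then have "cinner v (P *v v) = 0" unfolding rng_def by blast
    then have "cinner (P *v v) (P *v v) = 0"
      using assms by (metis adj orth_proj_fixes_rng rng_def rangeI)
    then show "P *v v = 0" by (simp only: cinner_self_eq_0)
  qed
qed

lemma hadj_matrix_vector_mult: "hadj ip (\<lambda>h. M *v T h) \<xi> = hadj ip T (cadj M *v \<xi>)"
  unfolding hadj_def by (simp add: cinner_matrix_vector_mult)

lemma G0_matrix_vector_mult: "G0 ip DA A (\<lambda>x. M *v \<tau> x) \<xi> = G0 ip DA A \<tau> (cadj M *v \<xi>)"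
  unfolding G0_def by (rule hadj_matrix_vector_mult)

lemma bij_betw_matrix_inv_image:
  fixes B :: "'a::field^'n^'n"
  assumes "invertible B"
  shows "bij_betw ((*v) B) ((*v) (matrix_inv B) ` R) R"
proof -
  have "B *v (matrix_inv B *v x) = x" for x
    using invertible_matrix_inv(1)[OF assms] by (simp add: matrix_vector_mul_assoc)
  then have "(*v) B ` (*v) (matrix_inv B) ` R = R"
    unfolding image_image by simp
  moreover have "inj ((*v) B)" using assms by (rule inj_matrix_vector_mult)
  ultimately show ?thesis by (simp add: bij_betw_def inj_on_def inj_def)
qed

lemma orth_proj_matrix_vector_mult_eq_0_iff:
  assumes "orth_proj P" and "orth_proj Q"
    and "(\<lambda>y. cadj M *v y) ` rng Q = rng P"
  shows "Q *v (M *v v) = 0 \<longleftrightarrow> P *v v = 0"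
proof -
  have "Q *v (M *v v) = 0 \<longleftrightarrow> (\<forall>y\<in>rng Q. cinner v (cadj M *v y) = 0)"
    using orth_proj_eq_0_iff_orthogonal[OF assms(2)] by (simp add: cinner_matrix_vector_mult)
  also have "\<dots> \<longleftrightarrow> (\<forall>z\<in>rng P. cinner v z = 0)"
    using assms(3) by (metis (no_types, lifting) image_eqI imageE)
  also have "\<dots> \<longleftrightarrow> P *v v = 0"
    using orth_proj_eq_0_iff_orthogonal[OF assms(1)] by simp
  finally show ?thesis .
qed

lemma Theta_M_boundary_condition_iff:
  assumes P: "orth_proj P" and PM: "orth_proj PM"
    and \<Theta>: "\<forall>x\<in>rng P. \<Theta> x \<in> rng P"
    and bij: "bij_betw (\<lambda>\<xi>. cadj M *v \<xi>) (rng PM) (rng P)"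
    and \<xi>: "\<xi> \<in> rng PM"
  shows "PM *v (M *v u) = Theta_M M P PM \<Theta> \<xi> \<longleftrightarrow> P *v u = \<Theta> (cadj M *v \<xi>)"
proof -
  let ?\<eta> = "cadj M *v \<xi>"
  have \<eta>: "?\<eta> \<in> rng P" using bij \<xi> by (auto simp: bij_betw_def)
  have "Theta_M M P PM \<Theta> \<xi> = PM *v (M *v \<Theta> ?\<eta>)"
    unfolding Theta_M_def using orth_proj_fixes_rng[OF PM \<xi>] orth_proj_fixes_rng[OF P] \<Theta> \<eta>
    by simp
  then have "PM *v (M *v u) = Theta_M M P PM \<Theta> \<xi> \<longleftrightarrow> PM *v (M *v (u - \<Theta> ?\<eta>)) = 0"
    by (simp add: matrix_vector_mult_diff_distrib)
  also have "\<dots> \<longleftrightarrow> P *v (u - \<Theta> ?\<eta>) = 0"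
    using P PM bij by (intro orth_proj_matrix_vector_mult_eq_0_iff) (auto simp: bij_betw_def)
  also have "\<dots> \<longleftrightarrow> P *v u = \<Theta> ?\<eta>"
    using orth_proj_fixes_rng[OF P] \<Theta> \<eta> by (simp add: matrix_vector_mult_diff_distrib)
  finally show ?thesis .
qed

lemma ext_graph_trace_change:
  assumes P: "orth_proj P" and PM: "orth_proj PM"
    and \<Theta>: "\<forall>x\<in>rng P. \<Theta> x \<in> rng P"
    and bij: "bij_betw (\<lambda>\<xi>. cadj M *v \<xi>) (rng PM) (rng P)"
  shows "ext_graph ip DA A (\<lambda>x. M *v \<tau> x) PM (Theta_M M P PM \<Theta>) = ext_graph ip DA A \<tau> P \<Theta>"
proof (intro set_eqI iffI)
  note boundary = Theta_M_boundary_condition_iff[OF P PM \<Theta> bij]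
  fix z
  assume "z \<in> ext_graph ip DA A (\<lambda>x. M *v \<tau> x) PM (Theta_M M P PM \<Theta>)"
  then obtain \<phi> \<xi> where z: "z = (\<phi> + G0 ip DA A \<tau> (cadj M *v \<xi>), A \<phi>)" "\<phi> \<in> DA"
    and \<xi>: "\<xi> \<in> rng PM" and cond: "PM *v (M *v \<tau> \<phi>) = Theta_M M P PM \<Theta> \<xi>"
    unfolding ext_graph_def G0_matrix_vector_mult by blast
  have "cadj M *v \<xi> \<in> rng P" using bij \<xi> by (auto simp: bij_betw_def)
  moreover have "P *v \<tau> \<phi> = \<Theta> (cadj M *v \<xi>)" using boundary[OF \<xi>] cond by simp
  ultimately show "z \<in> ext_graph ip DA A \<tau> P \<Theta>"
    unfolding ext_graph_def using z by blast
next
  note boundary = Theta_M_boundary_condition_iff[OF P PM \<Theta> bij]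
  fix z
  assume "z \<in> ext_graph ip DA A \<tau> P \<Theta>"
  then obtain \<phi> \<eta> where z: "z = (\<phi> + G0 ip DA A \<tau> \<eta>, A \<phi>)" "\<phi> \<in> DA"
    and \<eta>: "\<eta> \<in> rng P" and cond: "P *v \<tau> \<phi> = \<Theta> \<eta>"
    unfolding ext_graph_def by blast
  obtain \<xi> where \<xi>: "\<xi> \<in> rng PM" and \<eta>_eq: "\<eta> = cadj M *v \<xi>"
    using bij \<eta> by (auto simp: bij_betw_def)
  have "PM *v (M *v \<tau> \<phi>) = Theta_M M P PM \<Theta> \<xi>" using boundary[OF \<xi>] cond \<eta>_eq by simp
  then show "z \<in> ext_graph ip DA A (\<lambda>x. M *v \<tau> x) PM (Theta_M M P PM \<Theta>)"
    unfolding ext_graph_def G0_matrix_vector_mult using z \<xi> \<eta>_eq by blast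
qed

theorem lemma4p4:
  fixes scl :: "complex \<Rightarrow> 'h::ab_group_add \<Rightarrow> 'h"
    and ip :: "'h \<Rightarrow> 'h \<Rightarrow> complex"
    and DA :: "'h set" and A :: "'h \<Rightarrow> 'h"
    and \<tau> :: "'h \<Rightarrow> complex ^ 'n"
    and M P PM :: "complex ^ 'n ^ 'n"
    and \<Theta> :: "complex ^ 'n \<Rightarrow> complex ^ 'n"
  assumes H: "chilbert scl ip"
    and A_sa: "self_adjoint_op scl ip DA A"
    and A_pos: "strictly_pos ip DA (\<lambda>x. - A x)"
    and S_sym: "symmetric_op scl ip {x \<in> DA. \<tau> x = 0} A"
    and S_closed: "closed_op ip {x \<in> DA. \<tau> x = 0} A"
    and S_pos: "strictly_pos ip {x \<in> DA. \<tau> x = 0} (\<lambda>x. - A x)"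
    and S_def1: "def_index scl ip {x \<in> DA. \<tau> x = 0} A \<i> = CARD('n)"
    and S_def2: "def_index scl ip {x \<in> DA. \<tau> x = 0} A (- \<i>) = CARD('n)"
    and tau_lin: "lin_on scl (*s) DA \<tau>"
    and tau_surj: "\<tau> ` DA = UNIV"
    and tau_bdd: "\<exists>C. \<forall>x\<in>DA. norm (\<tau> x) \<le> C * (hnorm ip x + hnorm ip (A x))"
    and ker_dense: "hdense ip {x \<in> DA. \<tau> x = 0}"
    and M_inv: "invertible M"
    and E: "in_E P \<Theta>"
    and PM: "orth_proj PM"
    and PM_ran: "rng PM = (\<lambda>x. matrix_inv (cadj M) *v x) ` rng P"
  shows "ext_graph ip DA A (\<lambda>x. M *v \<tau> x) PM (Theta_M M P PM \<Theta>) = ext_graph ip DA A \<tau> P \<Theta>"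
proof (rule ext_graph_trace_change)
  show "orth_proj P" and "\<forall>x\<in>rng P. \<Theta> x \<in> rng P"
    using E unfolding in_E_def by auto
  show "bij_betw (\<lambda>\<xi>. cadj M *v \<xi>) (rng PM) (rng P)"
    unfolding PM_ran using bij_betw_matrix_inv_image[OF invertible_cadj[OF M_inv]] by simp
qed (rule PM)

end
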